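(* Let $p_1\ge p_2\ge\cdots>0$ be a non-increasing sequence of strictly positive reals with $\sum_{j=1}^\infty p_j=1$, and let $V_n=\operatorname{Var}(K_n)$, where $K_n$ is the number of boxes occupied by at least one of the first $n$ balls. The sequence $(V_n)$ is bounded if and only if there exists a positive integer $k$ such that the frequencies $(p_j)$ satisfy the condition $$\limsup_{j\to\infty}\frac{p_{j+k}}{p_j}\le\frac12 .\qquad( * )$$ Moreover, if $k$ is the least integer with the property $( * )$, then $(V_n)$ satisfies a sharp asymptotic bound $\limsup_{n\to\infty}V_n\le k$.
   Context: Infinite occupancy scheme: balls $1,2,\dots$ are thrown independently at boxes $j=1,2,\dots$, each ball landing in box $j$ with probability (frequency) $p_j$. $K_n$ is the number of boxes containing at least one of the first $n$ balls; equivalently, the number of distinct values among $n$ i.i.d. positive-integer-valued random variables with distribution $(p_j)$. *)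

theory Defs
  imports "HOL-Probability.Probability"
begin

text \<open>
  Boxes and balls are numbered from 0: \<open>p j\<close> is the probability of the \<open>(j+1)\<close>-st box.
\<close>

definition frequencies :: "(nat \<Rightarrow> real) \<Rightarrow> bool" where
  "frequencies p \<longleftrightarrow> decseq p \<and> (\<forall>j. 0 < p j) \<and> p sums 1"

text \<open>
  The sample points are the sequences of boxes hit by the successive balls, so the coordinates
  are i.i.d. with law \<open>p\<close>. This is meaningful only if \<open>frequencies p\<close>, since
  \<^const>\<open>embed_pmf\<close> is unspecified when \<open>p\<close> is not a probability mass function.
\<close>

definition throws :: "(nat \<Rightarrow> real) \<Rightarrow> (nat \<Rightarrow> nat) measure" where
  "throws p = (\<Pi>\<^sub>M i\<in>UNIV. measure_pmf (embed_pmf p))"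

definition occupied :: "nat \<Rightarrow> (nat \<Rightarrow> nat) \<Rightarrow> nat" where
  "occupied n \<omega> = card {j. \<exists>i<n. \<omega> i = j}"

definition occupied_variance :: "(nat \<Rightarrow> real) \<Rightarrow> nat \<Rightarrow> real" where
  "occupied_variance p n = prob_space.variance (throws p) (\<lambda>\<omega>. real (occupied n \<omega>))"

definition half_ratio :: "(nat \<Rightarrow> real) \<Rightarrow> nat \<Rightarrow> bool" where
  "half_ratio p k \<longleftrightarrow> limsup (\<lambda>j. ereal (p (j + k) / p j)) \<le> ereal (1 / 2)"

definition least_half_ratio :: "(nat \<Rightarrow> real) \<Rightarrow> nat \<Rightarrow> bool" where
  "least_half_ratio p k \<longleftrightarrow>
     k \<ge> 1 \<and> half_ratio p k \<and> (\<forall>i\<ge>1. half_ratio p i \<longrightarrow> k \<le> i)"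

end

theory Submission
  imports Defs
begin

text \<open>
  Writing \<open>q\<^sub>j = 1 - p\<^sub>j\<close>, let \<open>A\<^sub>n = \<Sum>\<^sub>j (q\<^sub>j\<^sup>n - q\<^sub>j\<^sup>2\<^sup>n)\<close> be the sum of the variances of the
  occupancy indicators and \<open>S\<^sub>n = \<Sum>\<^sub>j p\<^sub>j q\<^sub>j\<^sup>n\<^sup>-\<^sup>1\<close>. The indicators are negatively correlated, and their
  covariances add up to at least \<open>- n S\<^sub>n\<^sup>2\<close>, so \<open>A\<^sub>n - n S\<^sub>n\<^sup>2 \<le> V\<^sub>n \<le> A\<^sub>n\<close>. Since \<open>S\<^sub>n \<longlonglongrightarrow> 0\<close> and
  \<open>n S\<^sub>n \<le> 3 A\<^bsub>n div 2\<^esub>\<close>, a bound on \<open>V\<^sub>n\<close> gives \<open>A\<^sub>n \<le> C + A\<^bsub>n div 2\<^esub> / 2\<close> for large \<open>n\<close>, so \<open>V\<close> and \<open>A\<close>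
  are bounded together. If \<open>A\<close> is bounded, so is the number of frequencies in \<open>(p\<^sub>j/2, p\<^sub>j]\<close>,
  because each of them contributes a constant to \<open>A\<^sub>n\<close> for \<open>n\<close> about \<open>1/(2 p\<^sub>j)\<close>; this gives a
  half-ratio \<open>k\<close>. Conversely a half-ratio \<open>k\<close> makes \<open>A\<^sub>n\<close> telescope with step \<open>k\<close> up to an error
  \<open>d n S\<^sub>n\<close> with \<open>d\<close> arbitrarily small, whence the limsup is at most \<open>k\<close>. Repeating each of
  the frequencies \<open>2\<^sup>-\<^sup>m/(2k)\<close> exactly \<open>k\<close> times makes the telescoping asymptotically exact.
\<close>

section \<open>Power estimates, telescoping with step \<open>k\<close>, a halving recurrence\<close>

text \<open>Mean value estimate for \<open>x ^ n\<close> with the derivative taken at the larger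
  endpoint; \<open>power_diff_ge\<close> takes it at the smaller one. The truncated exponent at
  \<open>n = 0\<close> is harmless because of the factor \<open>n\<close>.\<close>

lemma power_diff_le:
  fixes a b :: real
  assumes "0 \<le> b" "b \<le> a"
  shows "a ^ n - b ^ n \<le> n * (a - b) * a ^ (n - 1)"
proof (induction n)
  case (Suc n)
  have "a ^ Suc n - b ^ Suc n = a * (a ^ n - b ^ n) + (a - b) * b ^ n"
    by (simp add: algebra_simps)
  also have "\<dots> \<le> a * (n * (a - b) * a ^ (n - 1)) + (a - b) * a ^ n"
    using assms Suc by (intro add_mono mult_left_mono power_mono) auto
  also have "\<dots> = Suc n * (a - b) * a ^ (Suc n - 1)"
    by (cases n) (auto simp: algebra_simps)
  finally show ?case .
qed simp

lemma power_diff_ge: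
  fixes a b :: real
  assumes "0 \<le> b" "b \<le> a"
  shows "n * (a - b) * b ^ (n - 1) \<le> a ^ n - b ^ n"
proof (induction n)
  case (Suc n)
  have "Suc n * (a - b) * b ^ (Suc n - 1) = b * (n * (a - b) * b ^ (n - 1)) + (a - b) * b ^ n"
    by (cases n) (auto simp: algebra_simps)
  also have "\<dots> \<le> b * (a ^ n - b ^ n) + (a - b) * a ^ n"
    using assms Suc by (intro add_mono mult_left_mono power_mono) auto
  also have "\<dots> = a ^ Suc n - b ^ Suc n"
    by (simp add: algebra_simps)
  finally show ?case .
qed simp

text \<open>Only \<open>k\<close> terms survive at either end of the telescoping; these boundary
  terms produce the constant \<open>k\<close> of the limsup bound.\<close>

lemma sum_shift_diff:
  fixes f :: "nat \<Rightarrow> 'a :: ab_group_add"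
  shows "(\<Sum>j<M. f (j + k) - f j) = (\<Sum>i<k. f (M + i)) - (\<Sum>i<k. f i)"
proof (induction M)
  case (Suc M)
  have "(\<Sum>i<k. f (Suc M + i)) - (\<Sum>i<k. f (M + i)) = f (M + k) - f M"
    using sum_lessThan_telescope[of "\<lambda>i. f (M + i)" k] by (simp add: sum_subtractf)
  with Suc show ?case
    by (simp add: algebra_simps)
qed simp

text \<open>The map sending \<open>x\<close> to \<open>C + x / 2\<close> has the fixed point
  \<open>2 * C\<close>, so any bound \<open>B \<ge> 2 * C\<close> propagates from
  \<open>n div 2\<close> to \<open>n\<close>.\<close>

lemma bounded_above_of_halving_recurrence:
  fixes a :: "nat \<Rightarrow> real"
  assumes "\<forall>\<^sub>F n in sequentially. a n \<le> C + a (n div 2) / 2"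
  obtains B where "\<And>n. a n \<le> B"
proof -
  obtain N where N: "\<And>n. N \<le> n \<Longrightarrow> a n \<le> C + a (n div 2) / 2"
    using assms by (auto simp: eventually_sequentially)
  define B where "B = max (2 * C) (Max (a ` {..N}))"
  have "a n \<le> B" for n
  proof (induction n rule: less_induct)
    case (less n)
    show ?case
    proof (cases "n \<le> N")
      case True
      then have "a n \<le> Max (a ` {..N})"
        by (intro Max_ge) auto
      then show ?thesis
        by (simp add: B_def)
    next
      case False
      then have "a n \<le> C + a (n div 2) / 2" and "a (n div 2) \<le> B"
        using N less by auto
      then show ?thesis
        using max.cobounded1[of "2 * C" "Max (a ` {..N})"] unfolding B_def by linarith
    qed
  qed
  then show ?thesis
    by (rule that)
qed

section \<open>The sample space and the probability of missing given boxes\<close>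

locale occupancy =
  fixes p :: "nat \<Rightarrow> real"
  assumes frequencies: "frequencies p"
begin

lemma p_pos: "0 < p j" and p_decseq: "decseq p" and p_sums: "p sums 1"
  using frequencies by (auto simp: frequencies_def)

lemma p_nonneg: "0 \<le> p j"
  using p_pos[of j] by simp

lemma p_summable: "summable p"
  using p_sums by (rule sums_summable)

lemma p_tendsto_0: "p \<longlonglongrightarrow> 0"
  using p_summable by (rule summable_LIMSEQ_zero)

lemma sum_p_le_1: "finite F \<Longrightarrow> sum p F \<le> 1"
  using sum_le_suminf[OF p_summable, of F] p_nonneg sums_unique[OF p_sums] by simp

lemma p_le_1: "p j \<le> 1"
  using sum_p_le_1[of "{j}"] by simp

lemma pmf_embed: "pmf (embed_pmf p) j = p j"
proof (rule pmf_embed_pmf)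
  have "(\<integral>\<^sup>+ j. ennreal (p j) \<partial>count_space UNIV) = (\<Sum>j. ennreal (p j))"
    by (rule nn_integral_count_space_nat)
  also have "\<dots> = ennreal (\<Sum>j. p j)"
    by (rule suminf_ennreal2) (simp_all add: p_nonneg p_summable)
  also have "(\<Sum>j. p j) = 1"
    using p_sums by (simp add: sums_iff)
  finally show "(\<integral>\<^sup>+ j. ennreal (p j) \<partial>count_space UNIV) = 1"
    by simp
qed (simp add: p_nonneg)

sublocale balls: product_prob_space "\<lambda>_::nat. measure_pmf (embed_pmf p)" UNIV
  by unfold_locales

sublocale T: prob_space "throws p"
  unfolding throws_def by (rule balls.P.prob_space_axioms)

lemma space_throws: "space (throws p) = UNIV"
  by (auto simp: throws_def space_PiM)

text \<open>Events of missing boxes are used because independence makes their probabilities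
  \<open>n\<close>-th powers; two-element sets \<open>F\<close> supply the joint probabilities for
  covariances.\<close>

definition missed :: "nat \<Rightarrow> nat set \<Rightarrow> (nat \<Rightarrow> nat) set" where
  "missed n F = {\<omega>. \<forall>i<n. \<omega> i \<notin> F}"

lemma missed_sets [measurable]: "missed n F \<in> sets (throws p)"
proof -
  have [measurable]: "(\<lambda>\<omega>. \<omega> i) \<in> throws p \<rightarrow>\<^sub>M count_space UNIV" for i
    unfolding throws_def by (subst measurable_cong_sets[OF refl sets_measure_pmf_count_space[symmetric]])
      (rule measurable_component_singleton, simp)
  have "{\<omega> \<in> space (throws p). \<forall>i<n. \<omega> i \<notin> F} \<in> sets (throws p)"
    by measurable
  then show ?thesis
    by (simp add: missed_def space_throws)
qed

lemma prob_missed: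
  assumes "finite F"
  shows "T.prob (missed n F) = (1 - sum p F) ^ n"
proof -
  let ?P = "embed_pmf p"
  have compl: "measure_pmf.prob ?P (- F) = 1 - sum p F"
    using measure_pmf.prob_compl[of F ?P] measure_measure_pmf_finite[OF assms, of ?P]
    by (simp add: pmf_embed Compl_eq_Diff_UNIV)
  have "missed n F = {\<omega> \<in> space (\<Pi>\<^sub>M i\<in>UNIV. measure_pmf ?P). \<forall>i\<in>{..<n}. \<omega> i \<in> - F}"
    by (auto simp: missed_def space_PiM)
  then have "emeasure (throws p) (missed n F) = (\<Prod>i<n. emeasure (measure_pmf ?P) (- F))"
    unfolding throws_def using balls.emeasure_PiM_Collect[of "{..<n}" "\<lambda>_. - F"] by auto
  also have "\<dots> = ennreal ((1 - sum p F) ^ n)"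
    using sum_p_le_1[OF assms]
    by (simp add: measure_pmf.emeasure_eq_measure compl ennreal_power)
  finally show ?thesis
    using sum_p_le_1[OF assms] by (simp add: T.emeasure_eq_measure)
qed

section \<open>Truncation to finitely many boxes\<close>

text \<open>As \<open>M\<close> minus a finite sum of indicators, the truncated count has moments
  computable from \<open>prob_missed\<close>. Without truncation, infinitely many boxes are
  missed.\<close>

definition occupied_below :: "nat \<Rightarrow> nat \<Rightarrow> (nat \<Rightarrow> nat) \<Rightarrow> real" where
  "occupied_below M n \<omega> = real M - (\<Sum>j<M. indicator (missed n {j}) \<omega>)"

lemma occupied_below_eq_card: "occupied_below M n \<omega> = card {j. j < M \<and> (\<exists>i<n. \<omega> i = j)}"
proof -
  have "occupied_below M n \<omega> = (\<Sum>j<M. 1 - indicator (missed n {j}) \<omega>)"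
    by (simp add: occupied_below_def sum_subtractf)
  also have "\<dots> = (\<Sum>j<M. indicator {j. \<exists>i<n. \<omega> i = j} j)"
    by (intro sum.cong) (auto simp: missed_def indicator_def)
  also have "\<dots> = card ({..<M} \<inter> {j. \<exists>i<n. \<omega> i = j})"
    using sum_indicator_eq_card[of "{..<M}" "{j. \<exists>i<n. \<omega> i = j}"]
    by (simp add: indicator_def flip: of_nat_sum)
  also have "{..<M} \<inter> {j. \<exists>i<n. \<omega> i = j} = {j. j < M \<and> (\<exists>i<n. \<omega> i = j)}"
    by auto
  finally show ?thesis .
qed

lemma occupied_below_nonneg: "0 \<le> occupied_below M n \<omega>"
  by (simp add: occupied_below_eq_card)

lemma occupied_below_le: "occupied_below M n \<omega> \<le> real n"
proof -
  have "card {j. j < M \<and> (\<exists>i<n. \<omega> i = j)} \<le> card (\<omega> ` {..<n})"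
    by (intro card_mono) auto
  also have "\<dots> \<le> n"
    using card_image_le[of "{..<n}" \<omega>] by simp
  finally show ?thesis
    by (simp add: occupied_below_eq_card)
qed

text \<open>The first \<open>n\<close> balls hit finitely many boxes, so the truncated count is
  constant from some \<open>M\<close> on.\<close>

lemma occupied_below_tendsto: "(\<lambda>M. occupied_below M n \<omega>) \<longlonglongrightarrow> real (occupied n \<omega>)"
proof (rule tendsto_eventually)
  have "finite (\<omega> ` {..<n})"
    by simp
  then obtain N where N: "\<And>j. j \<in> \<omega> ` {..<n} \<Longrightarrow> j < N"
    unfolding finite_nat_set_iff_bounded by blast
  have "occupied_below M n \<omega> = real (occupied n \<omega>)" if "N \<le> M" for M
  proof -
    have "{j. j < M \<and> (\<exists>i<n. \<omega> i = j)} = {j. \<exists>i<n. \<omega> i = j}"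
      using N that by fastforce
    then show ?thesis
      by (simp add: occupied_below_eq_card occupied_def)
  qed
  then show "\<forall>\<^sub>F M in sequentially. occupied_below M n \<omega> = real (occupied n \<omega>)"
    by (auto simp: eventually_sequentially)
qed

lemma occupied_below_measurable [measurable]: "occupied_below M n \<in> borel_measurable (throws p)"
  unfolding occupied_below_def by measurable

lemma occupied_measurable [measurable]: "(\<lambda>\<omega>. real (occupied n \<omega>)) \<in> borel_measurable (throws p)"
  by (rule borel_measurable_LIMSEQ_real[OF occupied_below_tendsto]) measurable

lemma occupied_le: "real (occupied n \<omega>) \<le> real n"
  using occupied_below_tendsto by (rule LIMSEQ_le_const2) (auto intro: occupied_below_le)

text \<open>Dominated convergence for the first and second moments: the counts are at most
  \<open>n\<close>, uniformly in \<open>M\<close>.\<close>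

lemma variance_occupied_below_tendsto:
  "(\<lambda>M. T.variance (occupied_below M n)) \<longlonglongrightarrow> occupied_variance p n"
proof -
  let ?Y = "\<lambda>M. occupied_below M n" and ?K = "\<lambda>\<omega>. real (occupied n \<omega>)"
  have sq_bound: "norm (?Y M \<omega> ^ 2) \<le> real n ^ 2" for M \<omega>
    using power_mono[OF occupied_below_le occupied_below_nonneg, of M n \<omega> 2] by simp
  have sq_bound': "norm (?K \<omega> ^ 2) \<le> real n ^ 2" for \<omega>
    using power_mono[OF occupied_le, of n \<omega> 2] by simp
  have int: "integrable (throws p) (?Y M)" for M
    by (rule T.integrable_const_bound[where B = "real n"])
      (auto simp: occupied_below_nonneg occupied_below_le)
  have int_sq: "integrable (throws p) (\<lambda>\<omega>. ?Y M \<omega> ^ 2)" for M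
    using sq_bound by (intro T.integrable_const_bound[where B = "real n ^ 2"] AE_I2) auto
  have int': "integrable (throws p) ?K"
    by (rule T.integrable_const_bound[where B = "real n"])
      (auto simp: occupied_le simp del: of_nat_le_iff)
  have int_sq': "integrable (throws p) (\<lambda>\<omega>. ?K \<omega> ^ 2)"
    using sq_bound' by (intro T.integrable_const_bound[where B = "real n ^ 2"] AE_I2) auto
  have "(\<lambda>M. T.expectation (?Y M)) \<longlonglongrightarrow> T.expectation ?K"
    by (rule integral_dominated_convergence[where w = "\<lambda>_. real n"])
      (auto simp: occupied_below_tendsto occupied_below_nonneg occupied_below_le)
  moreover have "(\<lambda>M. T.expectation (\<lambda>\<omega>. ?Y M \<omega> ^ 2)) \<longlonglongrightarrow> T.expectation (\<lambda>\<omega>. ?K \<omega> ^ 2)"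
    by (rule integral_dominated_convergence[where w = "\<lambda>_. real n ^ 2"])
      (auto intro!: tendsto_power occupied_below_tendsto simp: sq_bound[simplified])
  ultimately have "(\<lambda>M. T.expectation (\<lambda>\<omega>. ?Y M \<omega> ^ 2) - (T.expectation (?Y M)) ^ 2)
      \<longlonglongrightarrow> T.expectation (\<lambda>\<omega>. ?K \<omega> ^ 2) - (T.expectation ?K) ^ 2"
    by (intro tendsto_intros)
  then show ?thesis
    unfolding occupied_variance_def by (simp add: T.variance_eq int int_sq int' int_sq')
qed

section \<open>Covariances of the indicators of missed boxes\<close>

definition missed_cov :: "nat \<Rightarrow> nat \<Rightarrow> nat \<Rightarrow> real" where
  "missed_cov n i j = T.prob (missed n {i, j}) - (1 - p i) ^ n * (1 - p j) ^ n"

text \<open>Counting missed instead of occupied boxes changes only a sign and a constant, which the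
  variance ignores; a product of two missing indicators is the indicator of missing both
  boxes.\<close>

lemma variance_occupied_below:
  "T.variance (occupied_below M n) = (\<Sum>i<M. \<Sum>j<M. missed_cov n i j)"
proof -
  define X :: "(nat \<Rightarrow> nat) \<Rightarrow> real" where "X \<omega> = (\<Sum>j<M. indicator (missed n {j}) \<omega>)" for \<omega>
  have int: "integrable (throws p) (\<lambda>\<omega>. indicator (missed n F) \<omega> :: real)" for F
    by (intro integrable_real_indicator) (auto simp: T.emeasure_eq_measure)
  have sq: "X \<omega> ^ 2 = (\<Sum>i<M. \<Sum>j<M. indicator (missed n {i, j}) \<omega>)" for \<omega>
    unfolding X_def power2_eq_square sum_product
    by (intro sum.cong refl) (auto simp: missed_def indicator_def)
  have EX: "T.expectation X = (\<Sum>j<M. (1 - p j) ^ n)"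
    unfolding X_def using int by (subst Bochner_Integration.integral_sum) (auto simp: prob_missed space_throws)
  have EX2: "T.expectation (\<lambda>\<omega>. X \<omega> ^ 2) = (\<Sum>i<M. \<Sum>j<M. T.prob (missed n {i, j}))"
    unfolding sq using int
    by (simp add: Bochner_Integration.integral_sum Bochner_Integration.integrable_sum space_throws)
  have intX: "integrable (throws p) X"
    unfolding X_def using int by auto
  have intX2: "integrable (throws p) (\<lambda>\<omega>. X \<omega> ^ 2)"
    unfolding sq using int by auto
  have Y: "occupied_below M n = (\<lambda>\<omega>. real M - X \<omega>)"
    by (auto simp: occupied_below_def X_def)
  have "T.variance (occupied_below M n) = T.variance X"
    unfolding Y using intX by (simp add: T.prob_space power2_commute)
  also have "\<dots> = (\<Sum>i<M. \<Sum>j<M. T.prob (missed n {i, j})) - (\<Sum>j<M. (1 - p j) ^ n) ^ 2"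
    by (subst T.variance_eq[OF intX intX2]) (simp only: EX EX2)
  also have "\<dots> = (\<Sum>i<M. \<Sum>j<M. missed_cov n i j)"
    by (simp add: missed_cov_def power2_eq_square sum_product sum_subtractf)
  finally show ?thesis .
qed

lemma missed_cov_diag: "missed_cov n i i = (1 - p i) ^ n - (1 - p i) ^ (2 * n)"
  by (simp add: missed_cov_def prob_missed mult_2 power_add)

text \<open>The joint and the product probability are \<open>n\<close>-th powers of bases that
  differ by exactly \<open>p i * p j\<close>. Monotonicity gives the sign,
  \<open>power_diff_le\<close> the lower bound.\<close>

lemma missed_cov_off_diag:
  assumes "i \<noteq> j"
  shows "missed_cov n i j \<le> 0"
    and "- (n * (p i * (1 - p i) ^ (n - 1)) * (p j * (1 - p j) ^ (n - 1))) \<le> missed_cov n i j"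
proof -
  let ?a = "(1 - p i) * (1 - p j)" and ?b = "1 - (p i + p j)"
  have eq: "missed_cov n i j = ?b ^ n - ?a ^ n"
    using assms by (simp add: missed_cov_def prob_missed power_mult_distrib)
  have b: "0 \<le> ?b"
    using sum_p_le_1[of "{i, j}"] assms by simp
  have ab: "?a - ?b = p i * p j"
    by (simp add: algebra_simps)
  then have "?b \<le> ?a"
    using mult_nonneg_nonneg[OF p_nonneg[of i] p_nonneg[of j]] by linarith
  then show "missed_cov n i j \<le> 0"
    unfolding eq using b by (simp add: power_mono)
  have "?a ^ n - ?b ^ n \<le> n * (p i * p j) * ?a ^ (n - 1)"
    using power_diff_le[OF b \<open>?b \<le> ?a\<close>, of n] ab by simp
  also have "\<dots> = n * (p i * (1 - p i) ^ (n - 1)) * (p j * (1 - p j) ^ (n - 1))"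
    by (simp add: power_mult_distrib)
  finally show "- (n * (p i * (1 - p i) ^ (n - 1)) * (p j * (1 - p j) ^ (n - 1))) \<le> missed_cov n i j"
    unfolding eq by simp
qed

text \<open>The variance that \<open>K\<^sub>n\<close> would have if the boxes were occupied independently of each other.\<close>

definition indep_variance :: "nat \<Rightarrow> real" where
  "indep_variance n = (\<Sum>j. (1 - p j) ^ n - (1 - p j) ^ (2 * n))"

text \<open>For \<open>n \<ge> 1\<close>, the probability that the \<open>n\<close>-th ball hits an empty box.\<close>

definition new_box_prob :: "nat \<Rightarrow> real" where
  "new_box_prob n = (\<Sum>j. p j * (1 - p j) ^ (n - 1))"

section \<open>Comparison of the variance with the two series\<close>

lemma one_minus_p: "0 \<le> 1 - p j" "1 - p j < 1"
  using p_le_1[of j] p_pos[of j] by auto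

lemma one_minus_p_power: "0 \<le> (1 - p j) ^ n" "(1 - p j) ^ n \<le> 1"
  using one_minus_p[of j] by (auto intro: power_le_one)

lemma indep_variance_term:
  "0 \<le> (1 - p j) ^ n - (1 - p j) ^ (2 * n)" "(1 - p j) ^ n - (1 - p j) ^ (2 * n) \<le> n * p j"
proof -
  show "0 \<le> (1 - p j) ^ n - (1 - p j) ^ (2 * n)"
    using power_decreasing[OF _ one_minus_p(1) less_imp_le[OF one_minus_p(2)], of n "2 * n" j] by simp
  have "(1 - p j) ^ n - (1 - p j) ^ (2 * n) = (1 - p j) ^ n * (1 - (1 - p j) ^ n)"
    by (simp add: right_diff_distrib mult_2 power_add)
  also have "\<dots> \<le> 1 * (1 - (1 - p j) ^ n)"
    using one_minus_p_power[of j n] by (intro mult_right_mono) auto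
  also have "\<dots> \<le> n * p j"
    using power_diff_le[of "1 - p j" 1 n] one_minus_p[of j] by simp
  finally show "(1 - p j) ^ n - (1 - p j) ^ (2 * n) \<le> n * p j" .
qed

lemma summable_indep_variance: "summable (\<lambda>j. (1 - p j) ^ n - (1 - p j) ^ (2 * n))"
  by (rule summable_comparison_test'[where g = "\<lambda>j. n * p j", OF summable_mult[OF p_summable]])
    (simp only: real_norm_def abs_of_nonneg indep_variance_term)

lemma new_box_term: "0 \<le> p j * (1 - p j) ^ n" "p j * (1 - p j) ^ n \<le> p j"
  using mult_left_mono[OF one_minus_p_power(2) p_nonneg, of j j n]
    mult_nonneg_nonneg[OF p_nonneg one_minus_p_power(1), of j j n] by simp_all

lemma summable_new_box_prob: "summable (\<lambda>j. p j * (1 - p j) ^ n)"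
  by (rule summable_comparison_test'[where g = p, OF p_summable])
    (simp only: real_norm_def abs_of_nonneg new_box_term)

lemma sum_indep_variance_le:
  "finite F \<Longrightarrow> (\<Sum>j\<in>F. (1 - p j) ^ n - (1 - p j) ^ (2 * n)) \<le> indep_variance n"
  unfolding indep_variance_def
  by (rule sum_le_suminf[OF summable_indep_variance]) (simp_all only: indep_variance_term)

lemma sum_new_box_prob_le:
  "finite F \<Longrightarrow> (\<Sum>j\<in>F. p j * (1 - p j) ^ (n - 1)) \<le> new_box_prob n"
  unfolding new_box_prob_def
  by (rule sum_le_suminf[OF summable_new_box_prob]) (simp_all add: new_box_term)

lemma indep_variance_nonneg: "0 \<le> indep_variance n"
  using sum_indep_variance_le[of "{}"] by simp

lemma new_box_prob_nonneg: "0 \<le> new_box_prob n"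
  using sum_new_box_prob_le[of "{}"] by simp

text \<open>The off-diagonal covariances are dropped, being nonpositive; the resulting bound is
  uniform in \<open>M\<close>.\<close>

lemma occupied_variance_le: "occupied_variance p n \<le> indep_variance n"
proof (rule LIMSEQ_le_const2[OF variance_occupied_below_tendsto], intro exI allI impI)
  fix M
  have "(\<Sum>j<M. missed_cov n i j) \<le> missed_cov n i i" if "i < M" for i
  proof -
    have "(\<Sum>j<M. missed_cov n i j) \<le> (\<Sum>j<M. if j = i then missed_cov n i i else 0)"
      by (intro sum_mono) (auto intro: missed_cov_off_diag)
    with that show ?thesis
      by simp
  qed
  then have "(\<Sum>i<M. \<Sum>j<M. missed_cov n i j) \<le> (\<Sum>i<M. missed_cov n i i)"
    by (intro sum_mono) auto
  also have "\<dots> \<le> indep_variance n"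
    unfolding missed_cov_diag by (rule sum_indep_variance_le) simp
  finally show "T.variance (occupied_below M n) \<le> indep_variance n"
    by (simp add: variance_occupied_below)
qed

lemma occupied_variance_ge: "indep_variance n - n * new_box_prob n ^ 2 \<le> occupied_variance p n"
proof (rule LIMSEQ_le[OF _ variance_occupied_below_tendsto])
  show "(\<lambda>M. (\<Sum>j<M. (1 - p j) ^ n - (1 - p j) ^ (2 * n)) - n * new_box_prob n ^ 2)
      \<longlonglongrightarrow> indep_variance n - n * new_box_prob n ^ 2"
    unfolding indep_variance_def
    by (intro tendsto_intros summable_LIMSEQ summable_indep_variance)
  have "(\<Sum>j<M. (1 - p j) ^ n - (1 - p j) ^ (2 * n)) - n * new_box_prob n ^ 2
      \<le> T.variance (occupied_below M n)" for M
  proof -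
    let ?s = "\<lambda>j. p j * (1 - p j) ^ (n - 1)"
    \<comment> \<open>The diagonal also gives up \<open>n * ?s i * ?s j\<close>, so that the
      subtracted double sum is a full square.\<close>
    have "(if j = i then missed_cov n i i else 0) - n * ?s i * ?s j \<le> missed_cov n i j" for i j
    proof (cases "i = j")
      case True
      then show ?thesis
        using new_box_term(1)[of j "n - 1"] by simp
    qed (use missed_cov_off_diag(2)[of i j n] in auto)
    then have "(\<Sum>i<M. \<Sum>j<M. (if j = i then missed_cov n i i else 0) - n * ?s i * ?s j)
        \<le> (\<Sum>i<M. \<Sum>j<M. missed_cov n i j)"
      by (intro sum_mono)
    moreover have "(\<Sum>i<M. \<Sum>j<M. n * ?s i * ?s j) = n * (\<Sum>j<M. ?s j) ^ 2"
      unfolding power2_eq_square sum_product by (simp only: sum_distrib_left mult.assoc)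
    then have "(\<Sum>i<M. \<Sum>j<M. (if j = i then missed_cov n i i else 0) - n * ?s i * ?s j)
        = (\<Sum>i<M. missed_cov n i i) - n * (\<Sum>j<M. ?s j) ^ 2"
      by (simp add: sum_subtractf)
    moreover have "n * (\<Sum>j<M. ?s j) ^ 2 \<le> n * new_box_prob n ^ 2"
      by (intro mult_left_mono power_mono sum_nonneg sum_new_box_prob_le new_box_term(1)) simp_all
    ultimately show ?thesis
      by (simp add: variance_occupied_below missed_cov_diag)
  qed
  then show "\<exists>N. \<forall>M\<ge>N. (\<Sum>j<M. (1 - p j) ^ n - (1 - p j) ^ (2 * n)) - n * new_box_prob n ^ 2
      \<le> T.variance (occupied_below M n)"
    by blast
qed

text \<open>Halving the exponent leaves a spare factor \<open>(1 - p j) ^ m\<close>, and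
  \<open>m * p j * (1 - p j) ^ (m - 1)\<close> is at most \<open>1 - (1 - p j) ^ m\<close> by the
  mean value estimate; the product is a term of \<open>indep_variance m\<close>.\<close>

lemma n_new_box_prob_le:
  assumes "2 \<le> n"
  shows "n * new_box_prob n \<le> 3 * indep_variance (n div 2)"
proof -
  define m where "m = n div 2"
  \<comment> \<open>The factor 3 is the worst ratio of \<open>n\<close> to \<open>n div 2\<close>,
    reached at \<open>n = 3\<close>.\<close>
  have m: "1 \<le> m" "n \<le> 3 * m" "2 * m - 1 \<le> n - 1"
    using assms by (auto simp: m_def)
  have "n * (p j * (1 - p j) ^ (n - 1)) \<le> 3 * ((1 - p j) ^ m - (1 - p j) ^ (2 * m))" for j
  proof -
    let ?q = "1 - p j"
    have "n * (p j * ?q ^ (n - 1)) \<le> real (3 * m) * (p j * ?q ^ (2 * m - 1))"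
      using m one_minus_p[of j] p_nonneg[of j] new_box_term(1)
      by (intro mult_mono mult_left_mono power_decreasing) auto
    also have "?q ^ (2 * m - 1) = ?q ^ m * ?q ^ (m - 1)"
      using m by (simp flip: power_add add: mult_2)
    also have "real (3 * m) * (p j * (?q ^ m * ?q ^ (m - 1))) = 3 * (?q ^ m * (m * p j * ?q ^ (m - 1)))"
      by simp
    also have "\<dots> \<le> 3 * (?q ^ m * (1 - ?q ^ m))"
      using power_diff_ge[of ?q 1 m] one_minus_p[of j] one_minus_p_power(1)[of j m]
      by (intro mult_left_mono) auto
    also have "?q ^ m * (1 - ?q ^ m) = ?q ^ m - ?q ^ (2 * m)"
      by (simp add: right_diff_distrib mult_2 power_add)
    finally show ?thesis .
  qed
  then have "(\<Sum>j. n * (p j * (1 - p j) ^ (n - 1))) \<le> (\<Sum>j. 3 * ((1 - p j) ^ m - (1 - p j) ^ (2 * m)))"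
    by (intro suminf_le summable_mult summable_new_box_prob summable_indep_variance)
  then show ?thesis
    by (simp only: new_box_prob_def indep_variance_def m_def
      suminf_mult[OF summable_new_box_prob] suminf_mult[OF summable_indep_variance])
qed

section \<open>Bounded variance forces a half-ratio\<close>

lemma one_minus_p_power_tendsto_0: "(\<lambda>n. (1 - p j) ^ n) \<longlonglongrightarrow> 0"
  using one_minus_p[of j] by (intro LIMSEQ_power_zero) simp

text \<open>Dominated convergence for series, with the summable majorant \<open>p\<close>.\<close>

lemma new_box_prob_tendsto_0: "new_box_prob \<longlonglongrightarrow> 0"
proof -
  have "(\<lambda>n. \<Sum>j. p j * (1 - p j) ^ n) \<longlonglongrightarrow> (\<Sum>j::nat. 0)"
  proof (intro tannerys_theorem[where M = p, THEN conjunct2, THEN conjunct2])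
    show "(\<lambda>n. p j * (1 - p j) ^ n) \<longlonglongrightarrow> 0" for j
      using tendsto_mult_right_zero[OF one_minus_p_power_tendsto_0] .
    show "\<forall>\<^sub>F (j, n) in sequentially \<times>\<^sub>F sequentially. norm (p j * (1 - p j) ^ n) \<le> p j"
      by (intro always_eventually) (simp only: split_paired_All prod.case real_norm_def abs_of_nonneg new_box_term simp_thms)
  qed (simp_all add: p_summable)
  then show ?thesis
    by (intro LIMSEQ_offset[of new_box_prob 1]) (simp add: new_box_prob_def)
qed

lemma indep_variance_bounded:
  assumes "\<And>n. occupied_variance p n \<le> C"
  obtains B where "\<And>n. indep_variance n \<le> B"
proof -
  \<comment> \<open>Against the factor 3 of \<open>n_new_box_prob_le\<close>, the threshold 1/6
    leaves the coefficient 1/2 of the halving recurrence.\<close>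
  have "\<forall>\<^sub>F n in sequentially. new_box_prob n < 1 / 6"
    by (rule order_tendstoD(2)[OF new_box_prob_tendsto_0]) simp
  then have "\<forall>\<^sub>F n in sequentially. indep_variance n \<le> C + indep_variance (n div 2) / 2"
    using eventually_ge_at_top[of 2]
  proof eventually_elim
    case (elim n)
    have "n * new_box_prob n ^ 2 = new_box_prob n * (n * new_box_prob n)"
      by (simp add: power2_eq_square)
    also have "\<dots> \<le> 1 / 6 * (3 * indep_variance (n div 2))"
      using elim new_box_prob_nonneg[of n] n_new_box_prob_le[of n]
      by - (rule mult_mono, auto)
    finally show ?case
      using occupied_variance_ge[of n] assms[of n] by linarith
  qed
  then show ?thesis
    using that by (rule bounded_above_of_halving_recurrence)
qed

text \<open>The \<open>k\<close> frequencies from index \<open>j\<close> on agree up to a factor 2,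
  so one \<open>n\<close> puts every \<open>n * p i\<close> between 1/8 and 1/2, where each term is
  at least 1/32.\<close>

lemma indep_variance_ge_of_slow_decay:
  assumes "p j \<le> 1 / 2" "p j < 2 * p (j + k)"
  obtains n where "k / 32 \<le> indep_variance n"
proof -
  \<comment> \<open>Since \<open>1 / (2 * p j) \<ge> 1\<close>, taking the floor loses at most a
    factor 2, which keeps \<open>n * p j\<close> between 1/4 and 1/2.\<close>
  define n where "n = nat \<lfloor>1 / (2 * p j)\<rfloor>"
  have "1 \<le> 1 / (2 * p j)"
    using assms p_pos[of j] by (simp add: field_simps)
  then have "1 / (2 * p j) \<le> 2 * n" "n \<le> 1 / (2 * p j)"
    using of_nat_nat[of "\<lfloor>1 / (2 * p j)\<rfloor>", where 'a = real] floor_correct[of "1 / (2 * p j)"]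
      le_floor_iff[of 1 "1 / (2 * p j)"]
    unfolding n_def by linarith+
  then have n: "1 / 4 \<le> n * p j" "n * p j \<le> 1 / 2"
    using p_pos[of j] by (auto simp: field_simps)
  have "1 / 32 \<le> (1 - p i) ^ n - (1 - p i) ^ (2 * n)" if "i \<in> {j..<j + k}" for i
  proof -
    let ?q = "1 - p i"
    have i: "p i \<le> p j" "p j \<le> 2 * p i"
      using that assms decseqD[OF p_decseq, of j i] decseqD[OF p_decseq, of i "j + k"] by auto
    then have "n * p i \<le> n * p j" "n * p j \<le> n * (2 * p i)"
      by (auto intro: mult_left_mono)
    then have np: "1 / 8 \<le> n * p i" "n * p i \<le> 1 / 2"
      using n by linarith+
    have half: "1 / 2 \<le> ?q ^ n"
      using power_diff_le[of ?q 1 n] one_minus_p[of i] np by simp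
    have "1 / 8 * (1 / 2) \<le> n * p i * ?q ^ n"
      using np half by (intro mult_mono) auto
    also have "\<dots> \<le> n * p i * ?q ^ (n - 1)"
      using np one_minus_p[of i] by (intro mult_left_mono power_decreasing) auto
    also have "\<dots> \<le> 1 - ?q ^ n"
      using power_diff_ge[of ?q 1 n] one_minus_p[of i] by simp
    finally have "1 / 2 * (1 / 16) \<le> ?q ^ n * (1 - ?q ^ n)"
      using half by (intro mult_mono) auto
    then show ?thesis
      by (simp add: right_diff_distrib mult_2 power_add)
  qed
  then have "(\<Sum>i\<in>{j..<j + k}. 1 / 32) \<le> (\<Sum>i\<in>{j..<j + k}. (1 - p i) ^ n - (1 - p i) ^ (2 * n))"
    by (rule sum_mono)
  also have "\<dots> \<le> indep_variance n"
    by (rule sum_indep_variance_le) simp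
  finally show ?thesis
    using that[of n] by simp
qed

text \<open>For \<open>k > 32 * B\<close>, slow decay over \<open>k\<close> steps would push
  \<open>indep_variance\<close> above its bound \<open>B\<close>; hence the ratio is at most 1/2 for
  all large \<open>j\<close>, not merely in the limit.\<close>

lemma half_ratio_of_bounded:
  assumes "\<And>n. occupied_variance p n \<le> C"
  shows "\<exists>k\<ge>1. half_ratio p k"
proof -
  obtain B where B: "\<And>n. indep_variance n \<le> B"
    using assms indep_variance_bounded by blast
  obtain k :: nat where k: "32 * B < k"
    using reals_Archimedean2 by blast
  have "1 \<le> k"
    using k B[of 0] indep_variance_nonneg[of 0] by (cases k) auto
  have "\<forall>\<^sub>F j in sequentially. p j < 1 / 2"
    by (rule order_tendstoD(2)[OF p_tendsto_0]) simp
  then have "\<forall>\<^sub>F j in sequentially. ereal (p (j + k) / p j) \<le> ereal (1 / 2)"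
  proof eventually_elim
    case (elim j)
    have "\<not> p j < 2 * p (j + k)"
    proof
      assume "p j < 2 * p (j + k)"
      then obtain n where "k / 32 \<le> indep_variance n"
        using indep_variance_ge_of_slow_decay elim by (metis less_imp_le)
      with B[of n] k show False
        by linarith
    qed
    then show ?case
      using p_pos[of j] by (simp add: field_simps)
  qed
  then have "half_ratio p k"
    unfolding half_ratio_def by (rule Limsup_bounded)
  with \<open>1 \<le> k\<close> show ?thesis
    by blast
qed

section \<open>A half-ratio bounds the variance\<close>

text \<open>The limsup condition with slack \<open>d\<close>. The second conjunct keeps the base
  \<open>1 - (1 + d) * p j\<close> nonnegative, as the power estimates require.\<close>

lemma half_ratioD:
  assumes "half_ratio p k" "0 < d"
  shows "\<exists>I. \<forall>j\<ge>I. 2 * p (j + k) \<le> (1 + d) * p j \<and> (1 + d) * p j \<le> 1"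
proof -
  have "ereal (1 / 2) < ereal ((1 + d) / 2)"
    using assms by simp
  then have "\<forall>\<^sub>F j in sequentially. ereal (p (j + k) / p j) < ereal ((1 + d) / 2)"
    using assms unfolding half_ratio_def Limsup_le_iff by blast
  moreover have "\<forall>\<^sub>F j in sequentially. p j < 1 / (1 + d)"
    using assms by (intro order_tendstoD(2)[OF p_tendsto_0]) simp
  ultimately have "\<forall>\<^sub>F j in sequentially. 2 * p (j + k) \<le> (1 + d) * p j \<and> (1 + d) * p j \<le> 1"
  proof eventually_elim
    case (elim j)
    then show ?case
      using p_pos[of j] assms by (simp add: field_simps)
  qed
  then show ?thesis
    by (simp only: eventually_sequentially)
qed

text \<open>
  If \<open>2 p\<^sub>j\<^sub>+\<^sub>k = p\<^sub>j\<close> held exactly, then \<open>(1 - p\<^sub>j\<^sub>+\<^sub>k)\<^sup>2 \<ge> 1 - p\<^sub>j\<close> would make the sum over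
  \<open>j \<ge> k\<close> telescope with step \<open>k\<close>, leaving at most \<open>k\<close> boundary terms.
\<close>

lemma indep_variance_le:
  assumes d: "0 \<le> d"
    and ratio: "\<forall>j\<ge>I. 2 * p (j + k) \<le> (1 + d) * p j \<and> (1 + d) * p j \<le> 1"
  shows "indep_variance n \<le> (\<Sum>j<I + k. (1 - p j) ^ n) + k + d * (n * new_box_prob n)"
  unfolding indep_variance_def
proof (rule suminf_le_const[OF summable_indep_variance])
  fix M
  let ?a = "\<lambda>j. (1 - p j) ^ n - (1 - p j) ^ (2 * n)"
  let ?f = "\<lambda>j. (1 - p (I + j)) ^ n" and ?s = "\<lambda>j. p j * (1 - p j) ^ (n - 1)"
  have step: "?a (I + (j + k)) \<le> (?f (j + k) - ?f j) + d * (n * ?s (I + j))" for j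
  proof -
    \<comment> \<open>\<open>?b\<close> is \<open>?q\<close> lowered just enough to lie below
      \<open>?r ^ 2\<close> despite the slack; replacing \<open>?q ^ n\<close> by
      \<open>?b ^ n\<close> costs the error with factor \<open>d\<close>.\<close>
    let ?b = "1 - (1 + d) * p (I + j)" and ?q = "1 - p (I + j)" and ?r = "1 - p (I + (j + k))"
    have b: "0 \<le> ?b"
      using ratio[rule_format, of "I + j"] by simp
    have "?b \<le> 1 - 2 * p (I + (j + k))"
      using ratio[rule_format, of "I + j"] by (simp add: add.assoc)
    also have "\<dots> \<le> ?r ^ 2"
      by (simp add: power2_eq_square algebra_simps)
    finally have "?b ^ n \<le> ?r ^ (2 * n)"
      using b by (simp add: power_mult power_mono)
    moreover have "?q ^ n - ?b ^ n \<le> n * (?q - ?b) * ?q ^ (n - 1)"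
      using d p_nonneg[of "I + j"] by (intro power_diff_le b) (simp add: algebra_simps)
    moreover have "n * (?q - ?b) * ?q ^ (n - 1) = d * (n * ?s (I + j))"
      by (simp add: algebra_simps)
    ultimately show ?thesis
      by linarith
  qed
  \<comment> \<open>The telescoping reaches only the terms from \<open>I + k\<close> on; the earlier
    ones are bounded crudely by powers, whose finite sum vanishes as \<open>n\<close> grows.\<close>
  have "(\<Sum>j<M. ?a j) \<le> (\<Sum>j<I + k + M. ?a j)"
    by (intro sum_mono2) (simp_all only: indep_variance_term finite_lessThan, auto)
  also have "\<dots> = (\<Sum>j<I + k. ?a j) + (\<Sum>j<M. ?a (I + k + j))"
    by (induction M) (simp_all add: add.assoc)
  also have "\<dots> \<le> (\<Sum>j<I + k. (1 - p j) ^ n) + (k + d * (n * new_box_prob n))"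
  proof (rule add_mono)
    show "(\<Sum>j<I + k. ?a j) \<le> (\<Sum>j<I + k. (1 - p j) ^ n)"
      by (intro sum_mono) (simp only: diff_le_eq le_add_same_cancel1 one_minus_p_power)
    have "(\<Sum>j<M. ?a (I + k + j)) \<le> (\<Sum>j<M. (?f (j + k) - ?f j) + d * (n * ?s (I + j)))"
      using step by (intro sum_mono) (simp only: ac_simps)
    also have "\<dots> = (\<Sum>i<k. ?f (M + i)) - (\<Sum>i<k. ?f i) + d * (n * (\<Sum>j<M. ?s (I + j)))"
      by (simp only: sum.distrib sum_shift_diff[of ?f] sum_distrib_left)
    also have "\<dots> \<le> k + d * (n * new_box_prob n)"
    proof (rule add_mono)
      have "(\<Sum>i<k. ?f (M + i)) \<le> (\<Sum>i<k. 1)"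
        by (intro sum_mono one_minus_p_power)
      moreover have "0 \<le> (\<Sum>i<k. ?f i)"
        by (intro sum_nonneg one_minus_p_power)
      ultimately show "(\<Sum>i<k. ?f (M + i)) - (\<Sum>i<k. ?f i) \<le> k"
        by simp
      have "(\<Sum>j<M. ?s (I + j)) = (\<Sum>j\<in>(+) I ` {..<M}. ?s j)"
        by (subst sum.reindex) (auto simp: o_def)
      also have "\<dots> \<le> new_box_prob n"
        by (rule sum_new_box_prob_le) simp
      finally show "d * (n * (\<Sum>j<M. ?s (I + j))) \<le> d * (n * new_box_prob n)"
        using d by (intro mult_left_mono) auto
    qed
    finally show "(\<Sum>j<M. ?a (I + k + j)) \<le> k + d * (n * new_box_prob n)" .
  qed
  finally show "(\<Sum>j<M. ?a j) \<le> (\<Sum>j<I + k. (1 - p j) ^ n) + k + d * (n * new_box_prob n)"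
    by (simp only: add.assoc)
qed

lemma indep_variance_bounded_of_half_ratio:
  assumes "half_ratio p k"
  obtains B where "\<And>n. indep_variance n \<le> B"
proof -
  \<comment> \<open>With \<open>d = 1 / 6\<close>, the factor 3 of \<open>n_new_box_prob_le\<close>
    again yields the coefficient 1/2.\<close>
  obtain I where I: "\<forall>j\<ge>I. 2 * p (j + k) \<le> (1 + 1 / 6) * p j \<and> (1 + 1 / 6) * p j \<le> 1"
    using half_ratioD[OF assms, of "1 / 6"] by auto
  have "\<forall>\<^sub>F n in sequentially. indep_variance n \<le> real (I + k + k) + indep_variance (n div 2) / 2"
    using eventually_ge_at_top[of 2]
  proof eventually_elim
    case (elim n)
    have "(\<Sum>j<I + k. (1 - p j) ^ n) \<le> (\<Sum>j<I + k. 1)"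
      by (intro sum_mono one_minus_p_power)
    then show ?case
      using indep_variance_le[of "1 / 6" I k n, OF _ I] n_new_box_prob_le[OF elim] by simp
  qed
  then show ?thesis
    using that by (rule bounded_above_of_halving_recurrence)
qed

text \<open>Once \<open>indep_variance\<close> is known to be bounded,
  \<open>n * new_box_prob n\<close> is bounded too, so the error in \<open>indep_variance_le\<close>
  becomes arbitrarily small with \<open>d\<close>.\<close>

lemma limsup_occupied_variance_le:
  assumes "half_ratio p k"
  shows "limsup (\<lambda>n. ereal (occupied_variance p n)) \<le> ereal (real k)"
  unfolding Limsup_le_iff
proof (intro allI impI)
  fix y assume y: "ereal (real k) < y"
  obtain B where B: "\<And>n. indep_variance n \<le> B"
    using indep_variance_bounded_of_half_ratio[OF assms] by blast
  have "0 \<le> B"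
    using B[of 0] indep_variance_nonneg[of 0] by linarith
  obtain z where z: "ereal (real k) < ereal z" "ereal z < y"
    using ereal_dense2[OF y] by blast
  define e where "e = (z - k) / 2"
  have "0 < e"
    using z by (simp add: e_def)
  \<comment> \<open>The slack error is at most \<open>d * (3 * B)\<close>, hence at most
    \<open>e\<close>; adding 1 avoids a zero denominator when \<open>B = 0\<close>.\<close>
  define d where "d = e / (3 * B + 1)"
  have "0 < d"
    using \<open>0 < e\<close> \<open>0 \<le> B\<close> by (simp add: d_def)
  have "d * (3 * B) \<le> e"
    using \<open>0 < e\<close> \<open>0 \<le> B\<close> by (simp add: d_def field_simps)
  obtain I where I: "\<forall>j\<ge>I. 2 * p (j + k) \<le> (1 + d) * p j \<and> (1 + d) * p j \<le> 1"
    using half_ratioD[OF assms \<open>0 < d\<close>] by blast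
  have "(\<lambda>n. \<Sum>j<I + k. (1 - p j) ^ n) \<longlonglongrightarrow> (\<Sum>j<I + k. 0)"
    by (intro tendsto_sum one_minus_p_power_tendsto_0)
  then have "\<forall>\<^sub>F n in sequentially. (\<Sum>j<I + k. (1 - p j) ^ n) < e"
    using \<open>0 < e\<close> by (intro order_tendstoD(2)) auto
  then show "\<forall>\<^sub>F n in sequentially. ereal (occupied_variance p n) < y"
    using eventually_ge_at_top[of 2]
  proof eventually_elim
    case (elim n)
    have "d * (n * new_box_prob n) \<le> d * (3 * B)"
      using n_new_box_prob_le[OF elim(2)] B[of "n div 2"] \<open>0 < d\<close> by (intro mult_left_mono) auto
    moreover have "indep_variance n \<le> (\<Sum>j<I + k. (1 - p j) ^ n) + k + d * (n * new_box_prob n)"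
      using \<open>0 < d\<close> by (intro indep_variance_le[OF _ I]) simp
    moreover have "k + e + e = z"
      by (simp add: e_def)
    ultimately have "indep_variance n < z"
      using elim(1) \<open>d * (3 * B) \<le> e\<close> by linarith
    then have "ereal (occupied_variance p n) < ereal z"
      using occupied_variance_le[of n] by simp
    with z(2) show ?case
      by (rule less_trans[rotated])
  qed
qed

lemma bounded_occupied_variance:
  assumes "half_ratio p k"
  shows "bounded (range (occupied_variance p))"
proof -
  obtain B where B: "\<And>n. indep_variance n \<le> B"
    using indep_variance_bounded_of_half_ratio[OF assms] by blast
  have "0 \<le> occupied_variance p n" for n
    unfolding occupied_variance_def by (rule T.variance_positive)
  moreover have "occupied_variance p n \<le> B" for n
    using occupied_variance_le[of n] B[of n] by simp
  ultimately show ?thesis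
    by (auto simp: bounded_iff)
qed

section \<open>Sharpness under exact halving\<close>

text \<open>With \<open>r = p (j + k)\<close>, exact halving gives
  \<open>(1 - r) ^ 2 - (1 - p j) = r ^ 2\<close>. As
  \<open>n * r * (1 - r) ^ (n - 1) \<le> 1\<close>, the telescoping error per step is at most a term
  of \<open>new_box_prob n\<close>.\<close>

lemma indep_variance_ge:
  assumes halving: "\<And>j. 2 * p (j + k) = p j"
  shows "k - (\<Sum>j<k. (1 - p j) ^ n) - new_box_prob n \<le> indep_variance n"
proof (rule LIMSEQ_le_const2)
  let ?f = "\<lambda>j. (1 - p j) ^ n" and ?s = "\<lambda>j. p j * (1 - p j) ^ (n - 1)"
  \<comment> \<open>The upper boundary terms all tend to 1 as \<open>M\<close> grows, since the
    frequencies vanish; they contribute the full \<open>k\<close>.\<close>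
  have "(\<lambda>M. \<Sum>i<k. (1 - p (M + i)) ^ n) \<longlonglongrightarrow> (\<Sum>i<k. (1 - 0) ^ n)"
    by (intro tendsto_intros LIMSEQ_ignore_initial_segment p_tendsto_0)
  then show "(\<lambda>M. (\<Sum>i<k. ?f (M + i)) - (\<Sum>j<k. ?f j) - new_box_prob n)
      \<longlonglongrightarrow> k - (\<Sum>j<k. ?f j) - new_box_prob n"
    by (intro tendsto_diff tendsto_const) simp
  have step: "(?f (j + k) - ?f j) - ?s (j + k) \<le> ?f (j + k) - (1 - p (j + k)) ^ (2 * n)" for j
  proof -
    let ?r = "p (j + k)"
    have "n * ?r * (1 - ?r) ^ (n - 1) \<le> 1 - (1 - ?r) ^ n"
      using power_diff_ge[of "1 - ?r" 1 n] one_minus_p[of "j + k"] by simp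
    then have le_1: "n * ?r * (1 - ?r) ^ (n - 1) \<le> 1"
      using one_minus_p_power(1)[of "j + k" n] by linarith
    have "((1 - ?r) ^ 2) ^ n - (1 - p j) ^ n \<le> n * ((1 - ?r) ^ 2 - (1 - p j)) * ((1 - ?r) ^ 2) ^ (n - 1)"
      using one_minus_p[of j] halving[of j]
      by (intro power_diff_le) (auto simp: power2_eq_square algebra_simps)
    also have "(1 - ?r) ^ 2 - (1 - p j) = ?r ^ 2"
      unfolding halving[of j, symmetric] by (simp add: power2_eq_square algebra_simps)
    also have "n * ?r ^ 2 * ((1 - ?r) ^ 2) ^ (n - 1) = (n * ?r * (1 - ?r) ^ (n - 1)) * ?s (j + k)"
      by (simp add: power2_eq_square power_mult_distrib)
    also have "\<dots> \<le> 1 * ?s (j + k)"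
      by (intro mult_right_mono new_box_term(1) le_1)
    finally show ?thesis
      by (simp add: power_mult)
  qed
  have "(\<Sum>i<k. ?f (M + i)) - (\<Sum>j<k. ?f j) - new_box_prob n \<le> indep_variance n" for M
  proof -
    have "(\<Sum>j<M. ?s (j + k)) = (\<Sum>j\<in>(\<lambda>j. j + k) ` {..<M}. ?s j)"
      by (subst sum.reindex) (auto simp: o_def)
    also have "\<dots> \<le> new_box_prob n"
      by (rule sum_new_box_prob_le) simp
    finally have "(\<Sum>i<k. ?f (M + i)) - (\<Sum>j<k. ?f j) - new_box_prob n
        \<le> (\<Sum>j<M. (?f (j + k) - ?f j) - ?s (j + k))"
      by (simp only: sum_subtractf[of _ "\<lambda>j. ?s (j + k)"] sum_shift_diff[of ?f] diff_left_mono)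
    also have "\<dots> \<le> (\<Sum>j<M. ?f (j + k) - (1 - p (j + k)) ^ (2 * n))"
      by (intro sum_mono step)
    also have "\<dots> = (\<Sum>j\<in>(\<lambda>j. j + k) ` {..<M}. (1 - p j) ^ n - (1 - p j) ^ (2 * n))"
      by (subst sum.reindex) (auto simp: o_def)
    also have "\<dots> \<le> indep_variance n"
      by (rule sum_indep_variance_le) simp
    finally show ?thesis .
  qed
  then show "\<exists>N. \<forall>M\<ge>N. (\<Sum>i<k. ?f (M + i)) - (\<Sum>j<k. ?f j) - new_box_prob n \<le> indep_variance n"
    by blast
qed

lemma half_ratio_of_halving:
  assumes halving: "\<And>j. 2 * p (j + k) = p j"
  shows "half_ratio p k"
proof -
  have "p (j + k) / p j \<le> 1 / 2" for j
    unfolding halving[of j, symmetric] using p_pos[of "j + k"] by simp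
  then show ?thesis
    unfolding half_ratio_def by (intro Limsup_bounded always_eventually allI ereal_less_eq(3)[THEN iffD2])
qed

text \<open>The covariance loss \<open>n * new_box_prob n ^ 2\<close> is at most
  \<open>3 * B * new_box_prob n\<close> and so vanishes; the lower bound \<open>?g\<close> then
  tends to \<open>k\<close>.\<close>

lemma limsup_occupied_variance_eq:
  assumes halving: "\<And>j. 2 * p (j + k) = p j"
  shows "limsup (\<lambda>n. ereal (occupied_variance p n)) = ereal (real k)"
proof (rule antisym)
  have half: "half_ratio p k"
    using halving by (rule half_ratio_of_halving)
  show "limsup (\<lambda>n. ereal (occupied_variance p n)) \<le> ereal (real k)"
    using half by (rule limsup_occupied_variance_le)
  obtain B where B: "\<And>n. indep_variance n \<le> B"
    using indep_variance_bounded_of_half_ratio[OF half] by blast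
  let ?g = "\<lambda>n. k - (\<Sum>j<k. (1 - p j) ^ n) - new_box_prob n - new_box_prob n * (3 * B)"
  have "?g \<longlonglongrightarrow> real k - (\<Sum>j<k. 0) - 0 - 0 * (3 * B)"
    by (intro tendsto_diff tendsto_mult tendsto_sum tendsto_const new_box_prob_tendsto_0
      one_minus_p_power_tendsto_0)
  then have "limsup (\<lambda>n. ereal (?g n)) = ereal (real k)"
    by (intro lim_imp_Limsup) auto
  moreover have "limsup (\<lambda>n. ereal (?g n)) \<le> limsup (\<lambda>n. ereal (occupied_variance p n))"
  proof (rule Limsup_mono)
    show "\<forall>\<^sub>F n in sequentially. ereal (?g n) \<le> ereal (occupied_variance p n)"
      using eventually_ge_at_top[of 2]
    proof eventually_elim
      case (elim n)
      have "n * new_box_prob n ^ 2 = new_box_prob n * (n * new_box_prob n)"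
        by (simp add: power2_eq_square)
      also have "\<dots> \<le> new_box_prob n * (3 * B)"
        using n_new_box_prob_le[OF elim] B[of "n div 2"] new_box_prob_nonneg[of n]
        by (intro mult_left_mono) auto
      finally show ?case
        using occupied_variance_ge[of n] indep_variance_ge[OF halving, of n]
        by (intro ereal_less_eq(3)[THEN iffD2]) linarith
    qed
  qed
  ultimately show "ereal (real k) \<le> limsup (\<lambda>n. ereal (occupied_variance p n))"
    by simp
qed

end

section \<open>The dyadic example\<close>

definition dyadic_frequencies :: "nat \<Rightarrow> nat \<Rightarrow> real" where
  "dyadic_frequencies k j = (1 / 2) ^ (j div k) / (2 * k)"

lemma dyadic_halving:
  assumes "1 \<le> k"
  shows "2 * dyadic_frequencies k (j + k) = dyadic_frequencies k j"
  using assms by (simp add: dyadic_frequencies_def)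

lemma frequencies_dyadic:
  assumes "1 \<le> k"
  shows "frequencies (dyadic_frequencies k)"
  unfolding frequencies_def
proof (intro conjI allI)
  let ?p = "dyadic_frequencies k"
  show "decseq ?p"
    unfolding decseq_def dyadic_frequencies_def
    by (intro allI impI divide_right_mono power_decreasing div_le_mono) auto
  show "0 < ?p j" for j
    using assms by (simp add: dyadic_frequencies_def)
  have "(\<lambda>j. (1 / 2) ^ (j div k) / (2 * real k)) \<longlonglongrightarrow> 0 / (2 * real k)"
    using assms
    by (intro tendsto_divide tendsto_const filterlim_compose[OF LIMSEQ_power_zero]
      filterlim_at_top_div_const_nat) auto
  then have lim: "?p \<longlonglongrightarrow> 0"
    by (simp add: dyadic_frequencies_def[abs_def])
  \<comment> \<open>Halving turns each frequency into a difference with step \<open>k\<close>; the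
    first block has mass 1/2, so the total is \<open>- 2 * (0 - 1 / 2)\<close>.\<close>
  have telescope: "?p j = - 2 * (?p (j + k) - ?p j)" for j
    using dyadic_halving[OF assms, of j] by simp
  have "(\<Sum>j<M. ?p j) = - 2 * ((\<Sum>i<k. ?p (M + i)) - 1 / 2)" for M
  proof -
    have "(\<Sum>j<M. ?p j) = - 2 * (\<Sum>j<M. ?p (j + k) - ?p j)"
      unfolding sum_distrib_left by (rule sum.cong[OF refl]) (rule telescope)
    also have "\<dots> = - 2 * ((\<Sum>i<k. ?p (M + i)) - (\<Sum>i<k. ?p i))"
      by (simp only: sum_shift_diff)
    also have "(\<Sum>i<k. ?p i) = 1 / 2"
      using assms by (simp add: dyadic_frequencies_def)
    finally show ?thesis .
  qed
  moreover have "(\<lambda>M. - 2 * ((\<Sum>i<k. ?p (M + i)) - 1 / 2)) \<longlonglongrightarrow> - 2 * ((\<Sum>i<k. 0) - 1 / 2)"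
    by (intro tendsto_intros LIMSEQ_ignore_initial_segment lim)
  ultimately show "?p sums 1"
    by (simp add: sums_def)
qed

text \<open>A shift by \<open>i < k\<close> from the start of a block stays in that block, so the
  ratio equals 1 infinitely often.\<close>

lemma least_half_ratio_dyadic:
  assumes "1 \<le> k"
  shows "least_half_ratio (dyadic_frequencies k) k"
  unfolding least_half_ratio_def
proof (intro conjI allI impI)
  let ?p = "dyadic_frequencies k"
  interpret occupancy ?p
    by (rule occupancy.intro[OF frequencies_dyadic[OF assms]])
  show "half_ratio ?p k"
    using dyadic_halving[OF assms] by (rule half_ratio_of_halving)
  fix i assume i: "1 \<le> i" "half_ratio ?p i"
  show "k \<le> i"
  proof (rule ccontr)
    assume "\<not> k \<le> i"
    \<comment> \<open>A slack of 1/2 is below 1, so equal frequencies contradict the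
      inequality.\<close>
    obtain I where I: "\<forall>j\<ge>I. 2 * ?p (j + i) \<le> (1 + 1 / 2) * ?p j"
      using half_ratioD[OF i(2) half_gt_zero[OF zero_less_one]] by blast
    have "?p (I * k + i) = ?p (I * k)"
    proof -
      have "(I * k + i) div k = I * k div k"
        using \<open>\<not> k \<le> i\<close> by simp
      then show ?thesis
        unfolding dyadic_frequencies_def by (rule arg_cong)
    qed
    then have "2 * ?p (I * k) \<le> (1 + 1 / 2) * ?p (I * k)"
      using I[rule_format, of "I * k"] assms by simp
    then have "(2 :: real) \<le> 1 + 1 / 2"
      unfolding mult_le_cancel_right_pos[OF p_pos] .
    then show False
      by simp
  qed
qed (rule assms)

text \<open>Sharpness of the bound is expressed by the last conjunct: for every \<open>k\<close>
  some frequencies with least half-ratio \<open>k\<close> attain equality.\<close>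

theorem theorem1p2:
  shows "(\<forall>p. frequencies p \<longrightarrow>
            (bounded (range (occupied_variance p)) \<longleftrightarrow> (\<exists>k\<ge>1. half_ratio p k)) \<and>
            (\<forall>k. least_half_ratio p k \<longrightarrow>
                limsup (\<lambda>n. ereal (occupied_variance p n)) \<le> ereal (real k))) \<and>
         (\<forall>k\<ge>1. \<exists>p. frequencies p \<and> least_half_ratio p k \<and>
                limsup (\<lambda>n. ereal (occupied_variance p n)) = ereal (real k))"
proof (intro conjI allI impI)
  fix p assume "frequencies p"
  then interpret occupancy p
    by (rule occupancy.intro)
  show "bounded (range (occupied_variance p)) \<longleftrightarrow> (\<exists>k\<ge>1. half_ratio p k)"
  proof
    assume "bounded (range (occupied_variance p))"
    then obtain C where "\<And>n. \<bar>occupied_variance p n\<bar> \<le> C"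
      by (auto simp: bounded_iff)
    then have "\<And>n. occupied_variance p n \<le> C"
      by (rule abs_le_D1)
    then show "\<exists>k\<ge>1. half_ratio p k"
      by (rule half_ratio_of_bounded)
  qed (use bounded_occupied_variance in blast)
  show "limsup (\<lambda>n. ereal (occupied_variance p n)) \<le> ereal (real k)" if "least_half_ratio p k" for k
    using that limsup_occupied_variance_le by (simp add: least_half_ratio_def)
next
  fix k :: nat assume k: "1 \<le> k"
  interpret occupancy "dyadic_frequencies k"
    by (rule occupancy.intro[OF frequencies_dyadic[OF k]])
  show "\<exists>p. frequencies p \<and> least_half_ratio p k \<and>
      limsup (\<lambda>n. ereal (occupied_variance p n)) = ereal (real k)"
    using frequencies least_half_ratio_dyadic[OF k] limsup_occupied_variance_eq[OF dyadic_halving[OF k]]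
    by blast
qed

end
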